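(* Let $G$ be a topological group which is not strongly amenable, and let $(G,\Pi(G))$ be its universal minimal proximal flow. Then the action of $G$ on $\Pi(G)$ is effective at every $t\in G$ such that the subgroup $\langle\mathrm{Aut}(G)t\rangle$ is dense in $G$; that is, for every such $t$ there is some $x\in\Pi(G)$ with $tx\neq x$.
   Context: A topological group is a group with a Hausdorff topology such that $(x,y)\mapsto xy^{-1}$ is continuous. A flow $(G,X)$ consists of a topological group $G$ and a (nonempty) compact Hausdorff space $X$ with a jointly continuous action $G\times X\to X$, $(t,x)\mapsto tx$. A flow is minimal if every orbit is dense; proximal if for all $x,y\in X$ there is a net $\{t_n\}$ in $G$ with $\lim t_nx=\lim t_ny$. The universal minimal proximal flow $(G,\Pi(G))$ is the minimal proximal flow, unique up to isomorphism, such that every minimal proximal flow $(G,Y)$ is the image of $\Pi(G)$ under a continuous surjective $G$-equivariant map (existence and uniqueness are known). $G$ is strongly amenable if and only if $\Pi(G)$ is a single point. $\mathrm{Aut}(G)$ is the group of topological automorphisms of $G$, $\mathrm{Aut}(G)t=\{a(t)\mid a\in\mathrm{Aut}(G)\}$, and $\langle\mathrm{Aut}(G)t\rangle$ is the subgroup algebraically generated by it. *)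

theory Defs
  imports
    "HOL-Analysis.Analysis"
    "HOL-Algebra.Group_Action"
    "HOL-Algebra.Generated_Groups"
begin

locale topological_group = group G for G :: "('g, 'm) monoid_scheme" (structure) +
  fixes T :: "'g topology"
  assumes topspace_eq_carrier: "topspace T = carrier G"
    and Hausdorff_group: "Hausdorff_space T"
    and continuous_mult_inv: "continuous_map (prod_topology T T) T (\<lambda>(x, y). x \<otimes> inv y)"

locale flow =
  topological_group G T + group_action G "topspace X" \<phi>
  for G :: "('g, 'm) monoid_scheme" (structure) and T :: "'g topology"
    and X :: "'x topology" and \<phi> :: "'g \<Rightarrow> 'x \<Rightarrow> 'x" +
  assumes nonempty: "topspace X \<noteq> {}"
    and compact: "compact_space X"
    and Hausdorff: "Hausdorff_space X"
    and continuous_action: "continuous_map (prod_topology T X) X (\<lambda>(t, x). \<phi> t x)"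

definition minimal_flow ::
    "('g, 'm) monoid_scheme \<Rightarrow> 'g topology \<Rightarrow> 'x topology \<Rightarrow> ('g \<Rightarrow> 'x \<Rightarrow> 'x) \<Rightarrow> bool"
  where "minimal_flow G T X \<phi> \<longleftrightarrow>
    flow G T X \<phi> \<and> (\<forall>x \<in> topspace X. X closure_of (orbit G \<phi> x) = topspace X)"

text \<open>
  Nets in \<open>G\<close> are rendered, as usual in this library, by proper filters concentrated on
  \<open>carrier G\<close>: the net \<open>t\<^sub>n\<close> corresponds to the filter of sets that eventually contain it.
\<close>
definition proximal_flow ::
    "('g, 'm) monoid_scheme \<Rightarrow> 'g topology \<Rightarrow> 'x topology \<Rightarrow> ('g \<Rightarrow> 'x \<Rightarrow> 'x) \<Rightarrow> bool"
  where "proximal_flow G T X \<phi> \<longleftrightarrow>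
    flow G T X \<phi> \<and>
    (\<forall>x \<in> topspace X. \<forall>y \<in> topspace X. \<exists>(F :: 'g filter) z.
       F \<noteq> bot \<and> (\<forall>\<^sub>F t in F. t \<in> carrier G) \<and>
       limitin X (\<lambda>t. \<phi> t x) z F \<and> limitin X (\<lambda>t. \<phi> t y) z F)"

definition minimal_proximal_flow ::
    "('g, 'm) monoid_scheme \<Rightarrow> 'g topology \<Rightarrow> 'x topology \<Rightarrow> ('g \<Rightarrow> 'x \<Rightarrow> 'x) \<Rightarrow> bool"
  where "minimal_proximal_flow G T X \<phi> \<longleftrightarrow> minimal_flow G T X \<phi> \<and> proximal_flow G T X \<phi>"

definition flow_epimorphism ::
    "('g, 'm) monoid_scheme \<Rightarrow> 'x topology \<Rightarrow> ('g \<Rightarrow> 'x \<Rightarrow> 'x) \<Rightarrow>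
     'y topology \<Rightarrow> ('g \<Rightarrow> 'y \<Rightarrow> 'y) \<Rightarrow> ('x \<Rightarrow> 'y) \<Rightarrow> bool"
  where "flow_epimorphism G X \<phi> Y \<psi> f \<longleftrightarrow>
    continuous_map X Y f \<and> f ` topspace X = topspace Y \<and>
    (\<forall>t \<in> carrier G. \<forall>x \<in> topspace X. f (\<phi> t x) = \<psi> t (f x))"

text \<open>
  HOL cannot quantify over types inside a formula, so the factors \<open>Y\<close> below live on subsets of
  the fixed type \<open>'g set set\<close>. This is no restriction: a minimal flow is a Hausdorff space with
  a dense orbit, hence has at most \<open>2^(2^|G|)\<close> points, so every minimal flow on any type has an
  isomorphic copy there. Lemma \<open>universal_minimal_proximal_flowD\<close> below derives the universal
  property for flows on an arbitrary type.
\<close>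
definition universal_minimal_proximal_flow ::
    "('g, 'm) monoid_scheme \<Rightarrow> 'g topology \<Rightarrow> 'x topology \<Rightarrow> ('g \<Rightarrow> 'x \<Rightarrow> 'x) \<Rightarrow> bool"
  where "universal_minimal_proximal_flow G T X \<phi> \<longleftrightarrow>
    minimal_proximal_flow G T X \<phi> \<and>
    (\<forall>(Y :: 'g set set topology) \<psi>. minimal_proximal_flow G T Y \<psi> \<longrightarrow>
       (\<exists>f. flow_epimorphism G X \<phi> Y \<psi> f))"

definition strongly_amenable :: "('g, 'm) monoid_scheme \<Rightarrow> 'g topology \<Rightarrow> bool"
  where "strongly_amenable G T \<longleftrightarrow>
    (\<exists>(X :: 'g set set topology) \<phi> x.
       universal_minimal_proximal_flow G T X \<phi> \<and> topspace X = {x})"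

definition topological_automorphisms ::
    "('g, 'm) monoid_scheme \<Rightarrow> 'g topology \<Rightarrow> ('g \<Rightarrow> 'g) set"
  where "topological_automorphisms G T = {a \<in> auto G. homeomorphic_map T T a}"

lemma minimal_proximal_flow_copy:
  fixes G :: "('g, 'm) monoid_scheme" and Y :: "'y topology"
  assumes mp: "minimal_proximal_flow G T Y \<psi>"
  obtains Z :: "'g set set topology" and \<theta> h
  where "minimal_proximal_flow G T Z \<theta>" and "homeomorphic_map Z Y h"
    and "flow_epimorphism G Z \<theta> Y \<psi> h"
proof -
  interpret flow G T Y \<psi>
    using mp by (simp add: minimal_proximal_flow_def minimal_flow_def)
  have dense: "Y closure_of (orbit G \<psi> y) = topspace Y" if "y \<in> topspace Y" for y
    using mp that by (simp add: minimal_proximal_flow_def minimal_flow_def)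
  have acts: "\<psi> t y \<in> topspace Y" if "t \<in> carrier G" "y \<in> topspace Y" for t y
    using that surj_prop by blast
  obtain y0 where y0: "y0 \<in> topspace Y" using nonempty by blast
  define code :: "'y \<Rightarrow> 'g set set" where
    "code y = {A. A \<subseteq> carrier G \<and> y \<in> Y closure_of ((\<lambda>t. \<psi> t y0) ` A)}" for y
  have inj: "inj_on code (topspace Y)"
  proof (rule inj_onI, rule ccontr)
    fix y z assume y: "y \<in> topspace Y" and z: "z \<in> topspace Y"
      and eq: "code y = code z" and ne: "y \<noteq> z"
    obtain U V where U: "openin Y U" "y \<in> U" and V: "openin Y V" "z \<in> V" and UV: "disjnt U V"
      using Hausdorff y z ne unfolding Hausdorff_space_def by metis
    define A where "A = {t \<in> carrier G. \<psi> t y0 \<in> U}"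
    have "y \<in> Y closure_of ((\<lambda>t. \<psi> t y0) ` A)"
      unfolding in_closure_of
    proof (intro conjI allI impI)
      show "y \<in> topspace Y" by fact
      fix W assume W: "y \<in> W \<and> openin Y W"
      have "openin Y (U \<inter> W)" "y \<in> U \<inter> W" using U W by auto
      moreover have "y \<in> Y closure_of (orbit G \<psi> y0)" using dense y0 y by simp
      ultimately obtain p where "p \<in> orbit G \<psi> y0" "p \<in> U \<inter> W"
        unfolding in_closure_of by blast
      then show "\<exists>p. p \<in> (\<lambda>t. \<psi> t y0) ` A \<and> p \<in> W"
        unfolding orbit_def A_def by auto
    qed
    then have "A \<in> code y" by (auto simp: code_def A_def)
    then have "z \<in> Y closure_of ((\<lambda>t. \<psi> t y0) ` A)" using eq by (auto simp: code_def)
    then obtain p where "p \<in> (\<lambda>t. \<psi> t y0) ` A" "p \<in> V"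
      using V unfolding in_closure_of by blast
    then show False using UV by (auto simp: A_def disjnt_def)
  qed
  define C where "C = code ` topspace Y"
  define h where "h = inv_into (topspace Y) code"
  define Z where "Z = pullback_topology C h Y"
  define \<theta> where "\<theta> t = (\<lambda>c \<in> C. code (\<psi> t (h c)))" for t
  have hin: "h c \<in> topspace Y" and ch: "code (h c) = c" if "c \<in> C" for c
    using that by (auto simp: h_def C_def inv_into_into f_inv_into_f)
  have hc: "h (code y) = y" if "y \<in> topspace Y" for y
    using inj that by (simp add: h_def)
  have cin: "code y \<in> C" if "y \<in> topspace Y" for y using that by (simp add: C_def)
  have tZ: "topspace Z = C"
    using hin by (auto simp: Z_def topspace_pullback_topology)
  have "homeomorphic_maps Z Y h code"
    unfolding homeomorphic_maps_def
  proof (intro conjI ballI)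
    show hcont: "continuous_map Z Y h"
      using continuous_map_pullback[of Y Y id C h] by (simp add: Z_def)
    show "continuous_map Y Z code"
      unfolding Z_def
    proof (rule continuous_map_pullback')
      show "continuous_map Y Y (h \<circ> code)"
        by (rule continuous_map_eq[OF continuous_map_id]) (simp add: hc)
      show "topspace Y \<subseteq> code -` C" using cin by auto
    qed
  qed (auto simp: tZ ch hc)
  then have hcont: "continuous_map Z Y h" and ccont: "continuous_map Y Z code"
    and hom: "homeomorphic_map Z Y h" and homc: "homeomorphic_map Y Z code"
    and space: "Z homeomorphic_space Y"
    by (auto simp: homeomorphic_maps_def homeomorphic_map_maps homeomorphic_space_def
        homeomorphic_maps_sym)
  have \<theta>C: "\<theta> t c \<in> C" if "t \<in> carrier G" "c \<in> C" for t c
    using that by (simp add: \<theta>_def cin acts hin)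
  have h\<theta>: "h (\<theta> t c) = \<psi> t (h c)" if "t \<in> carrier G" "c \<in> C" for t c
    using that by (simp add: \<theta>_def hc acts hin)
  have \<theta>code: "\<theta> t (code y) = code (\<psi> t y)" if "y \<in> topspace Y" for t y
    using that by (simp add: \<theta>_def cin hc)
  have \<theta>mult: "\<theta> (s \<otimes>\<^bsub>G\<^esub> t) c = \<theta> s (\<theta> t c)" if "s \<in> carrier G" "t \<in> carrier G" "c \<in> C" for s t c
    using that by (simp add: \<theta>_def hc hin acts cin composition_rule)
  have \<theta>one: "\<theta> \<one>\<^bsub>G\<^esub> c = c" if "c \<in> C" for c
    using that fun_cong[OF id_eq_one, of "h c"] by (simp add: \<theta>_def hin ch)
  have Bij: "\<theta> t \<in> Bij C" if t: "t \<in> carrier G" for t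
  proof -
    have "bij_betw (\<theta> t) C C"
    proof (rule bij_betw_byWitness[where f' = "\<theta> (inv\<^bsub>G\<^esub> t)"])
      show "\<forall>c\<in>C. \<theta> (inv\<^bsub>G\<^esub> t) (\<theta> t c) = c" "\<forall>c\<in>C. \<theta> t (\<theta> (inv\<^bsub>G\<^esub> t) c) = c"
        using t by (auto simp: \<theta>mult[symmetric] \<theta>one)
    qed (use t \<theta>C in auto)
    then show ?thesis by (simp add: Bij_def \<theta>_def)
  qed
  have "group_action G (topspace Z) \<theta>"
    unfolding group_action_def group_hom_def group_hom_axioms_def tZ
  proof (intro conjI)
    show "group G" by (rule is_group)
    show "group (BijGroup C)" by (rule group_BijGroup)
    show "\<theta> \<in> hom G (BijGroup C)"
    proof (rule homI)
      fix s t assume st: "s \<in> carrier G" "t \<in> carrier G"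
      show "\<theta> (s \<otimes>\<^bsub>G\<^esub> t) = \<theta> s \<otimes>\<^bsub>BijGroup C\<^esub> \<theta> t"
      proof
        fix c
        show "\<theta> (s \<otimes>\<^bsub>G\<^esub> t) c = (\<theta> s \<otimes>\<^bsub>BijGroup C\<^esub> \<theta> t) c"
        proof (cases "c \<in> C")
          case True
          then show ?thesis using st Bij \<theta>mult by (simp add: BijGroup_def compose_eq)
        next
          case False
          then show ?thesis using st Bij by (simp add: BijGroup_def compose_def \<theta>_def)
        qed
      qed
    qed (use Bij in \<open>simp add: BijGroup_def\<close>)
  qed
  moreover have "continuous_map (prod_topology T Z) Z (\<lambda>(t, c). \<theta> t c)"
  proof -
    have "continuous_map (prod_topology T Z) (prod_topology T Y) (\<lambda>p. (fst p, (h \<circ> snd) p))"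
      by (intro continuous_map_pairedI continuous_map_fst continuous_map_compose[OF _ hcont]
          continuous_map_snd)
    then have "continuous_map (prod_topology T Z) Z
        (code \<circ> ((\<lambda>(t, x). \<psi> t x) \<circ> (\<lambda>p. (fst p, (h \<circ> snd) p))))"
      by (intro continuous_map_compose[OF _ ccont] continuous_map_compose[OF _ continuous_action])
    then show ?thesis
      by (rule continuous_map_eq) (auto simp: \<theta>_def tZ)
  qed
  ultimately have flowZ: "flow G T Z \<theta>"
    using nonempty compact Hausdorff homeomorphic_compact_space[OF space]
      homeomorphic_Hausdorff_space[OF space] topological_group_axioms
    by (simp add: flow_def flow_axioms_def tZ C_def)
  have "minimal_flow G T Z \<theta>"
    unfolding minimal_flow_def
  proof (intro conjI ballI flowZ)
    fix c assume "c \<in> topspace Z"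
    then have c: "c \<in> C" by (simp add: tZ)
    have "orbit G \<theta> c = code ` orbit G \<psi> (h c)"
      using c by (auto simp: orbit_def \<theta>_def)
    moreover have "orbit G \<psi> (h c) \<subseteq> topspace Y" using acts hin[OF c] by (auto simp: orbit_def)
    ultimately have "Z closure_of orbit G \<theta> c = code ` (Y closure_of orbit G \<psi> (h c))"
      using homeomorphic_map_closure_of[OF homc] by simp
    also have "\<dots> = topspace Z" using dense hin[OF c] by (simp add: tZ C_def)
    finally show "Z closure_of orbit G \<theta> c = topspace Z" .
  qed
  moreover have "proximal_flow G T Z \<theta>"
    unfolding proximal_flow_def
  proof (intro conjI ballI flowZ)
    fix c d assume "c \<in> topspace Z" "d \<in> topspace Z"
    then have c: "c \<in> C" and d: "d \<in> C" by (simp_all add: tZ)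
    obtain F z where F: "F \<noteq> bot" "\<forall>\<^sub>F t in F. t \<in> carrier G"
      "limitin Y (\<lambda>t. \<psi> t (h c)) z F" "limitin Y (\<lambda>t. \<psi> t (h d)) z F"
      using mp hin[OF c] hin[OF d] unfolding minimal_proximal_flow_def proximal_flow_def by blast
    have "limitin Z (code \<circ> (\<lambda>t. \<psi> t (h c))) (code z) F"
      "limitin Z (code \<circ> (\<lambda>t. \<psi> t (h d))) (code z) F"
      using F by (auto intro: continuous_map_limit[OF ccont])
    moreover have "code \<circ> (\<lambda>t. \<psi> t (h c)) = (\<lambda>t. \<theta> t c)" "code \<circ> (\<lambda>t. \<psi> t (h d)) = (\<lambda>t. \<theta> t d)"
      using c d by (auto simp: \<theta>_def)
    ultimately show "\<exists>(F :: 'g filter) z. F \<noteq> bot \<and> (\<forall>\<^sub>F t in F. t \<in> carrier G) \<and>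
        limitin Z (\<lambda>t. \<theta> t c) z F \<and> limitin Z (\<lambda>t. \<theta> t d) z F"
      using F by metis
  qed
  ultimately have "minimal_proximal_flow G T Z \<theta>"
    by (simp add: minimal_proximal_flow_def)
  moreover have "flow_epimorphism G Z \<theta> Y \<psi> h"
    using hcont homeomorphic_imp_surjective_map[OF hom] h\<theta>
    by (simp add: flow_epimorphism_def tZ)
  ultimately show thesis using that hom by blast
qed

lemma universal_minimal_proximal_flowD:
  fixes T :: "'g topology" and Y :: "'y topology"
  assumes "universal_minimal_proximal_flow G T X \<phi>" and "minimal_proximal_flow G T Y \<psi>"
  shows "\<exists>f. flow_epimorphism G X \<phi> Y \<psi> f"
proof -
  obtain Z :: "'g set set topology" and \<theta> h
    where Z: "minimal_proximal_flow G T Z \<theta>" and h: "flow_epimorphism G Z \<theta> Y \<psi> h"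
    using minimal_proximal_flow_copy[OF assms(2)] by metis
  obtain f where f: "flow_epimorphism G X \<phi> Z \<theta> f"
    using assms(1) Z unfolding universal_minimal_proximal_flow_def by blast
  have "f x \<in> topspace Z" if "x \<in> topspace X" for x
    using f that unfolding flow_epimorphism_def by blast
  moreover have "(h \<circ> f) ` topspace X = topspace Y"
    using f h by (simp only: flow_epimorphism_def image_comp[symmetric])
  ultimately have "flow_epimorphism G X \<phi> Y \<psi> (h \<circ> f)"
    using f h unfolding flow_epimorphism_def by (simp add: continuous_map_compose[of X Z f Y h])
  then show ?thesis by blast
qed

end

theory Submission
  imports Defs
begin

text \<open>
  The kernel of the action on \<open>\<Pi>(G)\<close> is a closed subgroup. Twisting a minimal proximal flow by a
  topological automorphism again gives a minimal proximal flow, which is therefore a factor of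
  \<open>\<Pi>(G)\<close>; hence the kernel is invariant under \<open>Aut(G)\<close>. If it contains \<open>t\<close>, it contains the closure
  of \<open>\<langle>Aut(G)t\<rangle>\<close>, so density makes the action trivial, and a minimal trivial flow is a point.
\<close>

lemma topological_automorphismsD:
  assumes "a \<in> topological_automorphisms G T"
  shows "a \<in> hom G G" and "bij_betw a (carrier G) (carrier G)" and "continuous_map T T a"
proof -
  have a: "a \<in> hom G G" "a \<in> Bij (carrier G)" "homeomorphic_map T T a"
    using assms unfolding topological_automorphisms_def auto_def by blast+
  show "a \<in> hom G G" by (fact a(1))
  show "bij_betw a (carrier G) (carrier G)" using a(2) unfolding Bij_def by blast
  show "continuous_map T T a" using a(3) by (rule homeomorphic_imp_continuous_map)
qed

text \<open>The twisted action is the composite homomorphism of \<open>a\<close> with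
  \<open>\<phi>\<close>. It is jointly continuous because it is the old action precomposed with the
  continuous map sending \<open>(t, x)\<close> to \<open>(a t, x)\<close>.\<close>

lemma flow_twist:
  assumes "flow G T X \<phi>" and a: "a \<in> topological_automorphisms G T"
  shows "flow G T X (\<phi> \<circ> a)"
proof -
  interpret flow G T X \<phi> by fact
  note a = topological_automorphismsD[OF a]
  have "\<phi> \<circ> a \<in> hom G (BijGroup (topspace X))"
    using Group.hom_compose[OF a(1) group_hom.homh[OF group_hom]] .
  then have "group_action G (topspace X) (\<phi> \<circ> a)"
    by (simp add: group_action_def group_hom_def group_hom_axioms_def group_BijGroup is_group)
  moreover have "continuous_map (prod_topology T X) X (\<lambda>(t, x). (\<phi> \<circ> a) t x)"
  proof -
    have "continuous_map (prod_topology T X) (prod_topology T X) (\<lambda>p. ((a \<circ> fst) p, snd p))"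
      by (intro continuous_map_pairedI continuous_map_compose[OF _ a(3)] continuous_map_fst
          continuous_map_snd)
    from continuous_map_compose[OF this continuous_action]
    show ?thesis by (simp add: o_def case_prod_beta')
  qed
  ultimately show ?thesis
    using topological_group_axioms nonempty compact Hausdorff
    by (simp add: flow_def flow_axioms_def)
qed

lemma orbit_eq_image: "orbit G \<phi> x = (\<lambda>t. \<phi> t x) ` carrier G"
  by (auto simp: orbit_def)

text \<open>Since \<open>a\<close> permutes the carrier, twisting only relabels which group element
  moves a point where; every orbit stays the same set.\<close>

lemma minimal_flow_twist:
  assumes "minimal_flow G T X \<phi>" and a: "a \<in> topological_automorphisms G T"
  shows "minimal_flow G T X (\<phi> \<circ> a)"
proof -
  have surj: "a ` carrier G = carrier G"
    using bij_betw_imp_surj_on[OF topological_automorphismsD(2)[OF a]] .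
  have "orbit G (\<phi> \<circ> a) x = (\<lambda>t. \<phi> t x) ` a ` carrier G" for x
    by (simp add: orbit_eq_image image_image)
  then have "orbit G (\<phi> \<circ> a) x = orbit G \<phi> x" for x
    by (simp only: surj orbit_eq_image)
  then show ?thesis
    using assms(1) by (simp add: minimal_flow_def flow_twist[OF _ a])
qed

text \<open>A filter witnessing proximality for \<open>\<phi>\<close> becomes a witness for the
  twisted action once it is pushed forward along the inverse of \<open>a\<close>.\<close>

lemma proximal_flow_twist:
  fixes G :: "('g, 'm) monoid_scheme"
  assumes "proximal_flow G T X \<phi>" and a: "a \<in> topological_automorphisms G T"
  shows "proximal_flow G T X (\<phi> \<circ> a)"
  unfolding proximal_flow_def
proof (intro conjI ballI)
  show "flow G T X (\<phi> \<circ> a)"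
    using assms(1) by (simp add: proximal_flow_def flow_twist[OF _ a])
next
  fix x y assume "x \<in> topspace X" "y \<in> topspace X"
  then obtain F :: "'g filter" and z where F: "F \<noteq> bot" "\<forall>\<^sub>F t in F. t \<in> carrier G"
    "limitin X (\<lambda>t. \<phi> t x) z F" "limitin X (\<lambda>t. \<phi> t y) z F"
    using assms unfolding proximal_flow_def by blast
  define b where "b = inv_into (carrier G) a"
  have surj: "a ` carrier G = carrier G"
    using bij_betw_imp_surj_on[OF topological_automorphismsD(2)[OF a]] .
  then have ab: "a (b t) = t" "b t \<in> carrier G" if "t \<in> carrier G" for t
    using that by (simp_all add: b_def f_inv_into_f inv_into_into)
  \<comment> \<open>The identity \<open>a (b t) = t\<close> is available only on the carrier; as
    \<open>F\<close> is concentrated there, it holds eventually, which suffices for limits.\<close>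
  have lim: "limitin X (\<lambda>t. (\<phi> \<circ> a) t w) z (filtermap b F)"
    if "limitin X (\<lambda>t. \<phi> t w) z F" for w
  proof -
    have "\<forall>\<^sub>F t in F. \<phi> (a (b t)) w = \<phi> t w"
      using F(2) by eventually_elim (simp add: ab)
    then have "limitin X (\<lambda>t. \<phi> (a (b t)) w) z F"
      by (rule limitin_transform_eventually[OF eventually_mono that]) simp
    then show ?thesis
      by (simp add: limitin_def eventually_filtermap)
  qed
  show "\<exists>(F :: 'g filter) z. F \<noteq> bot \<and> (\<forall>\<^sub>F t in F. t \<in> carrier G) \<and>
      limitin X (\<lambda>t. (\<phi> \<circ> a) t x) z F \<and> limitin X (\<lambda>t. (\<phi> \<circ> a) t y) z F"
  proof (intro exI conjI)
    show "filtermap b F \<noteq> bot" using F(1) by (simp add: filtermap_bot_iff)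
    show "\<forall>\<^sub>F t in filtermap b F. t \<in> carrier G"
      using F(2) by (auto simp: eventually_filtermap ab elim: eventually_mono)
  qed (use lim F in blast)+
qed

lemma minimal_proximal_flow_twist:
  assumes "minimal_proximal_flow G T X \<phi>" "a \<in> topological_automorphisms G T"
  shows "minimal_proximal_flow G T X (\<phi> \<circ> a)"
  using assms by (simp add: minimal_proximal_flow_def minimal_flow_twist proximal_flow_twist)

text \<open>For a flow this is the kernel of the homomorphism \<open>\<phi>\<close> into
  \<open>BijGroup (topspace X)\<close>. The pointwise form exhibits it as an intersection of
  stabilizers.\<close>

definition action_kernel ::
    "('g, 'm) monoid_scheme \<Rightarrow> 'x topology \<Rightarrow> ('g \<Rightarrow> 'x \<Rightarrow> 'x) \<Rightarrow> 'g set"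
  where "action_kernel G X \<phi> = {t \<in> carrier G. \<forall>x \<in> topspace X. \<phi> t x = x}"

lemma subgroup_action_kernel:
  assumes "flow G T X \<phi>"
  shows "subgroup (action_kernel G X \<phi>) G"
proof -
  interpret flow G T X \<phi> by fact
  have one: "\<phi> \<one>\<^bsub>G\<^esub> x = x" if "x \<in> topspace X" for x
    using fun_cong[OF id_eq_one, of x] that by simp
  show ?thesis
  proof (rule subgroupI)
    show "action_kernel G X \<phi> \<noteq> {}"
      using one by (auto simp: action_kernel_def)
    show "inv\<^bsub>G\<^esub> t \<in> action_kernel G X \<phi>" if "t \<in> action_kernel G X \<phi>" for t
      \<comment> \<open>\<open>orbit_sym_aux\<close> moves \<open>t\<close> to the other side of
        \<open>\<phi> t x = y\<close> as its inverse; here \<open>y = x\<close>.\<close>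
      using that orbit_sym_aux[of t _ _] by (simp add: action_kernel_def)
    show "s \<otimes>\<^bsub>G\<^esub> t \<in> action_kernel G X \<phi>"
      if "s \<in> action_kernel G X \<phi>" "t \<in> action_kernel G X \<phi>" for s t
      using that composition_rule by (auto simp: action_kernel_def)
  qed (auto simp: action_kernel_def)
qed

text \<open>Each stabilizer is the preimage of a closed point under the continuous orbit map of that
  point, and the kernel is the intersection of all stabilizers.\<close>

lemma closedin_action_kernel:
  assumes "flow G T X \<phi>"
  shows "closedin T (action_kernel G X \<phi>)"
proof -
  interpret flow G T X \<phi> by fact
  have "closedin T {t \<in> topspace T. \<phi> t x \<in> {x}}" if x: "x \<in> topspace X" for x
  proof (rule closedin_continuous_map_preimage)
    have "continuous_map T (prod_topology T X) (\<lambda>t. (t, x))"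
      using x by (intro continuous_map_pairedI) auto
    from continuous_map_compose[OF this continuous_action]
    show "continuous_map T X (\<lambda>t. \<phi> t x)" by (simp add: o_def)
    show "closedin X {x}" using x Hausdorff by (simp add: closedin_Hausdorff_singleton)
  qed
  \<comment> \<open>\<open>closedin_Inter\<close> asks for a nonempty family, supplied here by the
    points of \<open>X\<close>.\<close>
  then have "closedin T (\<Inter>x \<in> topspace X. {t \<in> topspace T. \<phi> t x \<in> {x}})"
    using nonempty by (intro closedin_Inter) auto
  moreover have "(\<Inter>x \<in> topspace X. {t \<in> topspace T. \<phi> t x \<in> {x}}) = action_kernel G X \<phi>"
    using nonempty unfolding action_kernel_def topspace_eq_carrier by blast
  ultimately show ?thesis by simp
qed

text \<open>Universality gives an equivariant map \<open>f\<close> of \<open>X\<close> onto its own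
  twist. If \<open>t\<close> fixes \<open>y\<close>, then \<open>a t\<close> fixes
  \<open>f y\<close>, and every point has the form \<open>f y\<close>.\<close>

lemma action_kernel_automorphism_invariant:
  fixes T :: "'g topology"
  assumes univ: "universal_minimal_proximal_flow G T X \<phi>"
    and a: "a \<in> topological_automorphisms G T" and t: "t \<in> action_kernel G X \<phi>"
  shows "a t \<in> action_kernel G X \<phi>"
proof -
  have "minimal_proximal_flow G T X (\<phi> \<circ> a)"
    using univ a by (simp add: universal_minimal_proximal_flow_def minimal_proximal_flow_twist)
  \<comment> \<open>The twist lives on the arbitrary point type \<open>'x\<close>, so the universal
    property is used in its form for all types.\<close>
  then obtain f where f: "flow_epimorphism G X \<phi> X (\<phi> \<circ> a) f"
    using universal_minimal_proximal_flowD[OF univ] by blast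
  have "\<phi> (a t) x = x" if x: "x \<in> topspace X" for x
  proof -
    have "x \<in> f ` topspace X" using f x by (simp add: flow_epimorphism_def)
    then obtain y where y: "y \<in> topspace X" "x = f y" by (elim imageE)
    have t: "t \<in> carrier G" "\<phi> t y = y"
      using t y(1) by (simp_all add: action_kernel_def)
    have "f (\<phi> t y) = (\<phi> \<circ> a) t (f y)"
      using f t(1) y(1) unfolding flow_epimorphism_def by blast
    then show ?thesis using y(2) t(2) by simp
  qed
  moreover have "a t \<in> carrier G"
    using t topological_automorphismsD(1)[OF a] by (auto simp: action_kernel_def hom_def)
  ultimately show ?thesis by (simp add: action_kernel_def)
qed

text \<open>Every orbit is a single point, which is closed by the Hausdorff property and dense by
  minimality.\<close>

lemma minimal_flow_trivial_action:
  assumes "minimal_flow G T X \<phi>" and triv: "action_kernel G X \<phi> = carrier G"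
  obtains x where "topspace X = {x}"
proof -
  interpret flow G T X \<phi> using assms by (simp add: minimal_flow_def)
  obtain x where x: "x \<in> topspace X" using nonempty by blast
  have "\<phi> t x = x" if "t \<in> carrier G" for t
    using that x triv unfolding action_kernel_def by blast
  \<comment> \<open>The carrier contains the unit, so the image of the constant map is
    \<open>{x}\<close> rather than empty.\<close>
  then have "orbit G \<phi> x = {x}"
    using one_closed by (simp add: orbit_eq_image cong: image_cong_simp) blast
  then have "topspace X = X closure_of {x}"
    using assms(1) x unfolding minimal_flow_def by metis
  also have "\<dots> = {x}"
    using x Hausdorff by (simp add: closure_of_eq closedin_Hausdorff_singleton)
  finally show thesis using that by blast
qed

lemma flow_epimorphism_compose:
  assumes "flow_epimorphism G X \<phi> Y \<psi> f" "flow_epimorphism G Y \<psi> Z \<theta> g"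
  shows "flow_epimorphism G X \<phi> Z \<theta> (g \<circ> f)"
proof -
  have "f x \<in> topspace Y" if "x \<in> topspace X" for x
    using assms(1) that unfolding flow_epimorphism_def by blast
  moreover have "(g \<circ> f) ` topspace X = topspace Z"
    using assms by (simp only: flow_epimorphism_def image_comp[symmetric])
  ultimately show ?thesis
    using assms continuous_map_compose[of X Y f Z g] by (simp add: flow_epimorphism_def)
qed

text \<open>Strong amenability asks for a one-point universal flow on the type
  \<open>'g set set\<close>, whereas \<open>X\<close> may live on any type. The copy
  \<open>Z\<close> of \<open>X\<close> on that type inherits universality by composing with its map
  onto \<open>X\<close>.\<close>

lemma strongly_amenable_if_singleton:
  fixes T :: "'g topology"
  assumes univ: "universal_minimal_proximal_flow G T X \<phi>" and x: "topspace X = {x}"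
  shows "strongly_amenable G T"
proof -
  obtain Z :: "'g set set topology" and \<theta> h
    where Z: "minimal_proximal_flow G T Z \<theta>" "homeomorphic_map Z X h"
      "flow_epimorphism G Z \<theta> X \<phi> h"
    using minimal_proximal_flow_copy univ unfolding universal_minimal_proximal_flow_def by metis
  have "universal_minimal_proximal_flow G T Z \<theta>"
    unfolding universal_minimal_proximal_flow_def
  proof (intro conjI allI impI)
    fix Y :: "'g set set topology" and \<psi>
    assume "minimal_proximal_flow G T Y \<psi>"
    then obtain f where "flow_epimorphism G X \<phi> Y \<psi> f"
      using univ unfolding universal_minimal_proximal_flow_def by blast
    with Z(3) show "\<exists>f. flow_epimorphism G Z \<theta> Y \<psi> f"
      by (blast intro: flow_epimorphism_compose)
  qed (fact Z(1))
  \<comment> \<open>A surjection onto a point does not bound the size of \<open>Z\<close>; the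
    injectivity of the homeomorphism \<open>h\<close> does.\<close>
  moreover have "bij_betw h (topspace Z) {x}"
    using Z(2) x by (simp add: homeomorphic_eq_everything_map bij_betw_def)
  then have "card (topspace Z) = 1"
    using bij_betw_same_card by fastforce
  then obtain z where "topspace Z = {z}"
    by (rule card_1_singletonE)
  ultimately show ?thesis
    unfolding strongly_amenable_def by blast
qed

theorem theorem2p4:
  fixes G :: "('g, 'm) monoid_scheme" and T :: "'g topology"
    and X :: "'x topology" and \<phi> :: "'g \<Rightarrow> 'x \<Rightarrow> 'x"
  assumes "topological_group G T"
    and "\<not> strongly_amenable G T"
    and "universal_minimal_proximal_flow G T X \<phi>"
  shows "\<forall>t \<in> carrier G.
    T closure_of (generate G {a t | a. a \<in> topological_automorphisms G T}) = carrier G \<longrightarrow>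
    (\<exists>x \<in> topspace X. \<phi> t x \<noteq> x)"
proof (intro ballI impI, rule ccontr)
  fix t assume t: "t \<in> carrier G"
    and dense: "T closure_of (generate G {a t | a. a \<in> topological_automorphisms G T}) = carrier G"
    and triv: "\<not> (\<exists>x \<in> topspace X. \<phi> t x \<noteq> x)"
  let ?K = "action_kernel G X \<phi>"
  interpret topological_group G T by fact
  have min: "minimal_flow G T X \<phi>"
    using assms(3) by (simp add: universal_minimal_proximal_flow_def minimal_proximal_flow_def)
  then have flow: "flow G T X \<phi>" by (simp add: minimal_flow_def)
  have "t \<in> ?K" using t triv by (simp add: action_kernel_def)
  then have "{a t | a. a \<in> topological_automorphisms G T} \<subseteq> ?K"
    using action_kernel_automorphism_invariant[OF assms(3)] by blast
  then have "generate G {a t | a. a \<in> topological_automorphisms G T} \<subseteq> ?K"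
    by (rule generate_subgroup_incl[OF _ subgroup_action_kernel[OF flow]])
  \<comment> \<open>The closure of the generated subgroup is the whole group by density, and it lies
    in every closed set containing that subgroup.\<close>
  then have "carrier G \<subseteq> ?K"
    using closure_of_minimal[OF _ closedin_action_kernel[OF flow]] dense by blast
  then have "?K = carrier G" by (auto simp: action_kernel_def)
  then obtain x where x: "topspace X = {x}" by (rule minimal_flow_trivial_action[OF min])
  show False using strongly_amenable_if_singleton[OF assms(3) x] assms(2) by contradiction
qed

end
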